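(* Let $G$ be a graph and let $n=|V(G)|$. For each edge $e\in E(G)$, the zeros of $\mathcal{LM}(G,x)$ and $\mathcal{LM}(G-e,x)$ interlace in the sense that, if $\alpha_1\leq\cdots\leq\alpha_n$ and $\beta_1\leq\cdots\leq\beta_n$ are respectively the zeros (listed with multiplicity) of $\mathcal{LM}(G,x)$ and $\mathcal{LM}(G-e,x)$, then $$\beta_1\leq\alpha_1\leq\beta_2\leq\alpha_2\leq\cdots\leq\beta_n\leq\alpha_n.$$ Also, if $G$ is connected, then $\lambda(\mathcal{LM}(G,x))>\lambda(\mathcal{LM}(H,x))$ for any proper subgraph $H$ of $G$.
   Context: All graphs are finite, undirected, without loops or multiple edges; graphs and subgraphs are understood to have nonempty vertex set. A proper subgraph of $G$ is any subgraph (not necessarily induced or spanning) different from $G$. $G-e$ is the graph obtained from $G$ by deleting the edge $e$ (keeping all vertices). $V(G)$ and $E(G)$ are the vertex and edge sets and $d_G(v)$ is the degree of $v$ in $G$. A matching of $G$ is a set $M\subseteq E(G)$ (possibly empty) no two distinct edges of which share an endpoint; $V(M)$ is the set of endpoints of edges in $M$. The Laplacian matching polynomial of $G$ is $$\mathcal{LM}(G,x)=\sum_{M}(-1)^{|M|}\prod_{v\in V(G)\setminus V(M)}\big(x-d_G(v)\big),$$ where $M$ ranges over all matchings of $G$. It has degree $|V(G)|$, and all its roots are known to be real and nonnegative. For a real-rooted polynomial $f(x)$, $\lambda(f(x))$ denotes its largest zero. *)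

theory Defs
  imports "HOL-Computational_Algebra.Computational_Algebra"
begin

record 'a graph =
  verts :: "'a set"
  edges :: "'a set set"

text \<open>An edge is the two-element set of its endpoints, so loops and multiple edges cannot occur.\<close>

definition simple_graph :: "'a graph \<Rightarrow> bool" where
  "simple_graph G \<longleftrightarrow>
     finite (verts G) \<and> verts G \<noteq> {} \<and> (\<forall>e\<in>edges G. e \<subseteq> verts G \<and> card e = 2)"

definition delete_edge :: "'a graph \<Rightarrow> 'a set \<Rightarrow> 'a graph" where
  "delete_edge G e = \<lparr>verts = verts G, edges = edges G - {e}\<rparr>"

definition subgraph :: "'a graph \<Rightarrow> 'a graph \<Rightarrow> bool" where
  "subgraph H G \<longleftrightarrow> simple_graph H \<and> verts H \<subseteq> verts G \<and> edges H \<subseteq> edges G"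

definition proper_subgraph :: "'a graph \<Rightarrow> 'a graph \<Rightarrow> bool" where
  "proper_subgraph H G \<longleftrightarrow> subgraph H G \<and> H \<noteq> G"

definition connected_graph :: "'a graph \<Rightarrow> bool" where
  "connected_graph G \<longleftrightarrow> (\<forall>u\<in>verts G. \<forall>v\<in>verts G. (u, v) \<in> {(x, y). {x, y} \<in> edges G}\<^sup>*)"

definition vertex_degree :: "'a graph \<Rightarrow> 'a \<Rightarrow> nat" where
  "vertex_degree G v = card {e \<in> edges G. v \<in> e}"

definition matching :: "'a graph \<Rightarrow> 'a set set \<Rightarrow> bool" where
  "matching G M \<longleftrightarrow> M \<subseteq> edges G \<and> pairwise disjnt M"

definition laplacian_matching_poly :: "'a graph \<Rightarrow> real poly" where
  "laplacian_matching_poly G =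
     (\<Sum>M | matching G M. (-1) ^ card M * (\<Prod>v\<in>verts G - \<Union>M. [:- real (vertex_degree G v), 1:]))"

text \<open>The real zeros in increasing order, repeated according to multiplicity. For nonzero
  \<open>p\<close> the list has \<open>degree p\<close> entries exactly when all zeros of \<open>p\<close> are real.\<close>

definition zeros_list :: "real poly \<Rightarrow> real list" where
  "zeros_list p = sorted_list_of_multiset (proots p)"

text \<open>Only meaningful for nonzero polynomials with at least one real zero.\<close>

definition largest_zero :: "real poly \<Rightarrow> real" where
  "largest_zero p = Max {x. poly p x = 0}"

end

theory Submission
  imports Defs
begin

text \<open>
  Deleting \<open>e = uv\<close> lowers the degrees of \<open>u\<close> and \<open>v\<close>, and the terms for matchings through \<open>e\<close> cancel:
  with matching sums taken in \<open>G - e\<close>, weighted by its degrees, \<open>LM(G)\<close> is \<open>LM(G - e)\<close> minus the sums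
  over \<open>V - u\<close> and \<open>V - v\<close>. The usual vertex recurrence shows that the sum over \<open>T\<close> divided by the
  sum over \<open>T - v\<close> maps the upper half plane into itself; hence so does \<open>LM(G) / LM(G - e)\<close>. For two
  monic polynomials of equal degree this forces interlacing: common zeros can be divided out,
  afterwards all zeros of the denominator are simple with residues of one sign, and the
  intermediate value theorem locates the zeros of the numerator.

  For the largest zero, let \<open>m\<close> be the largest zero of any matching sum over a vertex subset of \<open>G\<close>.
  If the sum over a proper subset \<open>T\<close> vanished at \<open>m\<close>, with \<open>T\<close> minimal, then adding to \<open>T\<close> an
  adjacent vertex (connectedness) would give a subset with negative sum. So \<open>m\<close> is a zero of
  \<open>LM(G)\<close>, and positivity at every \<open>y \<ge> m\<close>, strict on proper subsets, becomes strict on all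
  subsets once an edge is deleted and is preserved by further deletions.
\<close>

section \<open>Matching sums over vertex subsets and their recurrences\<close>

definition matchings_within :: "'a set set \<Rightarrow> 'a set \<Rightarrow> 'a set set set" where
  "matchings_within E T = {M. M \<subseteq> E \<inter> Pow T \<and> pairwise disjnt M}"

text \<open>The weights stay fixed when vertices leave \<open>T\<close>, unlike degrees in an
  induced subgraph; this makes the recurrences hold. The ring is arbitrary so that the sum can be
  taken in polynomials or after evaluation at a real or complex point.\<close>

definition matching_sum :: "'a set set \<Rightarrow> ('a \<Rightarrow> 'b::comm_ring_1) \<Rightarrow> 'a set \<Rightarrow> 'b" where
  "matching_sum E a T =
     (\<Sum>M\<in>matchings_within E T. (-1) ^ card M * (\<Prod>v\<in>T - \<Union>M. a v))"

lemma finite_matchings_within: "finite T \<Longrightarrow> finite (matchings_within E T)"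
  by (rule finite_subset[of _ "Pow (Pow T)"]) (auto simp: matchings_within_def)

lemma matching_sum_empty:
  assumes "\<forall>e\<in>E. card e = 2"
  shows "matching_sum E a {} = 1"
proof -
  have "{} \<notin> E" using assms by auto
  then have "E \<inter> Pow {} = {}" by auto
  then have "matchings_within E {} = {{}}"
    unfolding matchings_within_def by (auto simp del: Pow_empty)
  then show ?thesis by (simp add: matching_sum_def)
qed

lemma matching_sum_cong:
  assumes "E \<inter> Pow T = E' \<inter> Pow T" "\<And>v. v \<in> T \<Longrightarrow> a v = b v"
  shows "matching_sum E a T = matching_sum E' b T"
proof -
  have "matchings_within E T = matchings_within E' T"
    using assms(1) by (simp add: matchings_within_def)
  moreover have "(\<Prod>v\<in>T - \<Union>M. a v) = (\<Prod>v\<in>T - \<Union>M. b v)" for M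
    by (rule prod.cong) (simp_all add: assms(2))
  ultimately show ?thesis by (simp add: matching_sum_def)
qed

lemma poly_matching_sum:
  "poly (matching_sum E a T) x = matching_sum E (\<lambda>v. poly (a v) x) T"
  by (simp add: matching_sum_def poly_sum poly_prod)

text \<open>A matching either misses \<open>v\<close>, which then contributes the factor
  \<open>a v\<close>, or contains exactly one edge \<open>{u, v}\<close>; removing that edge flips
  the sign and leaves a matching inside \<open>T - {u, v}\<close>.\<close>

lemma matching_sum_expand:
  assumes fin: "finite T" and v: "v \<in> T" and E: "\<forall>e\<in>E. card e = 2"
  shows "matching_sum E a T = a v * matching_sum E a (T - {v})
           - (\<Sum>u | u \<in> T \<and> {u, v} \<in> E. matching_sum E a (T - {u, v}))"
proof -
  define N where "N = {u. u \<in> T \<and> {u, v} \<in> E}"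
  define t where "t T M = (-1) ^ card M * (\<Prod>x\<in>T - \<Union>M. a x)" for T M
  let ?W = "matchings_within E"
  have ms: "matching_sum E a S = sum (t S) (?W S)" for S
    by (simp add: matching_sum_def t_def)
  have vN: "v \<notin> N" using E by (force simp: N_def)
  have split: "?W T = ?W (T - {v}) \<union> (\<Union>u\<in>N. insert {u, v} ` ?W (T - {u, v}))" (is "_ = _ \<union> ?B")
  proof (intro equalityI subsetI)
    fix M assume M: "M \<in> ?W T"
    show "M \<in> ?W (T - {v}) \<union> ?B"
    proof (cases "v \<in> \<Union>M")
      case False
      then show ?thesis using M by (auto simp: matchings_within_def)
    next
      case True
      then obtain e where e: "e \<in> M" "v \<in> e" by blast
      then have "card e = 2" "e \<subseteq> T" "e \<in> E" using M E by (auto simp: matchings_within_def)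
      then obtain u where u: "e = {u, v}" "u \<noteq> v" using e(2) by (auto simp: card_2_iff)
      have uN: "u \<in> N" using \<open>e \<in> E\<close> \<open>e \<subseteq> T\<close> u by (auto simp: N_def)
      have "disjnt e e'" if "e' \<in> M - {e}" for e'
        using M e(1) that by (auto simp: matchings_within_def pairwise_def)
      then have "e' \<subseteq> T - {u, v}" if "e' \<in> M - {e}" for e'
        using that M unfolding u(1) matchings_within_def disjnt_def by blast
      then have "M - {e} \<in> ?W (T - {u, v})"
        using M by (auto simp: matchings_within_def pairwise_def)
      moreover have "M = insert {u, v} (M - {e})" using e(1) u by auto
      ultimately show ?thesis using uN by blast
    qed
  next
    fix M assume "M \<in> ?W (T - {v}) \<union> ?B"
    then show "M \<in> ?W T"
    proof
      assume "M \<in> ?W (T - {v})"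
      then show ?thesis by (auto simp: matchings_within_def)
    next
      assume "M \<in> ?B"
      then obtain u M' where M: "u \<in> N" "M = insert {u, v} M'" "M' \<in> ?W (T - {u, v})" by blast
      then have "disjnt {u, v} e \<and> disjnt e {u, v}" if "e \<in> M'" for e
        using that by (auto simp: matchings_within_def disjnt_def)
      then show ?thesis
        using M v by (auto simp: matchings_within_def N_def pairwise_insert)
    qed
  qed
  have notin: "{u, v} \<notin> M" if "M \<in> ?W (T - {u, v})" for u M
    using that by (auto simp: matchings_within_def)
  have disj0: "?W (T - {v}) \<inter> ?B = {}"
    by (auto simp: matchings_within_def)
  \<comment> \<open>A common element would contain both \<open>{u, v}\<close> and
    \<open>{u', v}\<close>, but the remaining edges of \<open>M\<close> avoid
    \<open>v\<close>.\<close>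
  have disj1: "(insert {u, v} ` ?W (T - {u, v})) \<inter> (insert {u', v} ` ?W (T - {u', v})) = {}"
    if "u \<in> N" "u' \<in> N" "u \<noteq> u'" for u u'
  proof -
    have False if A: "M \<in> ?W (T - {u, v})" "insert {u, v} M = insert {u', v} M'" for M M'
    proof -
      have "{u', v} \<in> insert {u, v} M" using A by auto
      moreover have "{u', v} \<noteq> {u, v}" using \<open>u \<noteq> u'\<close> by (auto simp: doubleton_eq_iff)
      ultimately show False using A(1) by (auto simp: matchings_within_def)
    qed
    then show ?thesis by auto
  qed
  have fN: "finite N" using fin by (simp add: N_def)
  have fW: "finite (?W S)" if "S \<subseteq> T" for S
    using fin that finite_matchings_within finite_subset by metis
  have "sum (t T) (?W T) = sum (t T) (?W (T - {v})) + sum (t T) ?B"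
    unfolding split by (rule sum.union_disjoint) (use disj0 fW fN in auto)
  also have "sum (t T) (?W (T - {v})) = a v * sum (t (T - {v})) (?W (T - {v}))"
    unfolding sum_distrib_left
  proof (rule sum.cong[OF refl])
    fix M assume M: "M \<in> ?W (T - {v})"
    then have "T - \<Union>M = insert v (T - {v} - \<Union>M)" using v by (auto simp: matchings_within_def)
    then have "(\<Prod>x\<in>T - \<Union>M. a x) = a v * (\<Prod>x\<in>T - {v} - \<Union>M. a x)" using fin by simp
    then show "t T M = a v * t (T - {v}) M" by (simp add: t_def mult.left_commute)
  qed
  also have "sum (t T) ?B = (\<Sum>u\<in>N. sum (t T) (insert {u, v} ` ?W (T - {u, v})))"
    by (rule sum.UNION_disjoint) (use fN fW disj1 in auto)
  also have "\<dots> = (\<Sum>u\<in>N. - sum (t (T - {u, v})) (?W (T - {u, v})))"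
  proof (rule sum.cong[OF refl])
    fix u assume u: "u \<in> N"
    have inj: "inj_on (insert {u, v}) (?W (T - {u, v}))"
      using notin by (intro inj_onI) (metis insert_ident)
    have "t T (insert {u, v} M) = - t (T - {u, v}) M" if M: "M \<in> ?W (T - {u, v})" for M
    proof -
      have "finite M" using M fin
        by (intro finite_subset[of M "Pow T"]) (auto simp: matchings_within_def)
      then have "card (insert {u, v} M) = Suc (card M)" using notin[OF M] by simp
      moreover have "T - \<Union>(insert {u, v} M) = T - {u, v} - \<Union>M" by auto
      ultimately show ?thesis unfolding t_def by simp
    qed
    then show "sum (t T) (insert {u, v} ` ?W (T - {u, v})) = - sum (t (T - {u, v})) (?W (T - {u, v}))"
      by (simp add: sum.reindex[OF inj] sum_negf)
  qed
  finally show ?thesis unfolding ms N_def[symmetric] sum_negf by simp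
qed

text \<open>In the expansion at \<open>v\<close> the weight of \<open>v\<close> appears only in the
  factor \<open>a v\<close>, so the sum is affine in it, with slope the sum over
  \<open>T - {v}\<close>.\<close>

lemma matching_sum_add_weight:
  assumes "finite T" "v \<in> T" "\<forall>e\<in>E. card e = 2"
  shows "matching_sum E (a(v := a v + c)) T = matching_sum E a T + c * matching_sum E a (T - {v})"
proof -
  have "matching_sum E (a(v := a v + c)) (T - insert v X) = matching_sum E a (T - insert v X)" for X
    by (rule matching_sum_cong) auto
  from this[of "{}"] this[of "{_}"] show ?thesis
    unfolding matching_sum_expand[OF assms]
    by (simp add: algebra_simps insert_commute)
qed

text \<open>When both sums are expanded at \<open>v\<close>, they differ only in the term for the
  neighbour \<open>u\<close>.\<close>

lemma matching_sum_delete_edge: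
  assumes fin: "finite T" and E: "\<forall>e\<in>E. card e = 2" and e: "{u, v} \<in> E" "u \<in> T" "v \<in> T"
  shows "matching_sum (E - {{u, v}}) a T = matching_sum E a T + matching_sum E a (T - {u, v})"
proof -
  let ?E = "E - {{u, v}}"
  have c: "matching_sum ?E a (T - insert v X) = matching_sum E a (T - insert v X)" for X
    by (rule matching_sum_cong) auto
  have N: "{w. w \<in> T \<and> {w, v} \<in> E} = insert u {w. w \<in> T \<and> {w, v} \<in> ?E}"
    using e by (auto simp: doubleton_eq_iff)
  have E': "\<forall>e\<in>?E. card e = 2" using E by auto
  have "finite {w. w \<in> T \<and> {w, v} \<in> ?E}" using fin by simp
  then have "(\<Sum>w | w \<in> T \<and> {w, v} \<in> E. matching_sum E a (T - {w, v})) =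
      matching_sum E a (T - {u, v}) + (\<Sum>w | w \<in> T \<and> {w, v} \<in> ?E. matching_sum E a (T - {w, v}))"
    unfolding N by (subst sum.insert) auto
  with c[of "{}"] c[of "{_}"] show ?thesis
    by (simp add: matching_sum_expand[OF fin e(3) E] matching_sum_expand[OF fin e(3) E'] insert_commute)
qed

text \<open>Here \<open>b\<close> stands for the Laplacian weights of a graph and \<open>a\<close>
  for those after deleting the edge. Lowering both weights by 1 produces a term over
  \<open>T - {u, v}\<close>, which cancels the contribution of the matchings through the
  edge.\<close>

lemma matching_sum_laplacian_edge:
  assumes fin: "finite T" and E: "\<forall>e\<in>E. card e = 2"
    and e: "{u, v} \<in> E" "u \<in> T" "v \<in> T"
    and b: "b = (\<lambda>w. if w = u \<or> w = v then a w - 1 else a w)"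
  shows "matching_sum E b T = matching_sum (E - {{u, v}}) a T
    - matching_sum (E - {{u, v}}) a (T - {u}) - matching_sum (E - {{u, v}}) a (T - {v})"
proof -
  let ?E = "E - {{u, v}}"
  have uv: "u \<noteq> v" using E e(1) by force
  have E': "\<forall>e\<in>?E. card e = 2" using E by auto
  define a' where "a' = a(u := a u + - 1)"
  have b': "b = a'(v := a' v + - 1)" using uv by (auto simp: b a'_def)
  have "matching_sum E b T = matching_sum ?E b T - matching_sum E b (T - {u, v})"
    using matching_sum_delete_edge[OF fin E e, of b] by (simp add: algebra_simps)
  also have "matching_sum E b (T - {u, v}) = matching_sum ?E a (T - {u, v})"
    by (rule matching_sum_cong) (auto simp: b)
  also have "matching_sum ?E b T = matching_sum ?E a' T - matching_sum ?E a' (T - {v})"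
    unfolding b' using matching_sum_add_weight[OF fin e(3) E', of a' "- 1"] by simp
  also have "matching_sum ?E a' T = matching_sum ?E a T - matching_sum ?E a (T - {u})"
    unfolding a'_def using matching_sum_add_weight[OF fin e(2) E', of a "- 1"] by simp
  also have "matching_sum ?E a' (T - {v}) =
      matching_sum ?E a (T - {v}) - matching_sum ?E a (T - {v} - {u})"
    unfolding a'_def using matching_sum_add_weight[of "T - {v}" u ?E a "- 1"] fin e(2) uv E' by simp
  also have "T - {v} - {u} = T - {u, v}" by auto
  finally show ?thesis by simp
qed

abbreviation edge_degree :: "'a set set \<Rightarrow> 'a \<Rightarrow> nat" where
  "edge_degree E v \<equiv> card {e \<in> E. v \<in> e}"

lemma edge_degree_delete_edge:
  assumes "finite E" "{u, v} \<in> E"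
  shows "edge_degree E w = edge_degree (E - {{u, v}}) w + (if w = u \<or> w = v then 1 else 0)"
proof -
  define D where "D = {e \<in> E. w \<in> e}"
  have del: "{e \<in> E - {{u, v}}. w \<in> e} = D - {{u, v}}"
    by (auto simp: D_def)
  have "finite D" using assms(1) by (simp add: D_def)
  moreover have "{u, v} \<in> D \<longleftrightarrow> w = u \<or> w = v" using assms(2) by (auto simp: D_def)
  ultimately have "card D = card (D - {{u, v}}) + (if w = u \<or> w = v then 1 else 0)"
    by (cases "{u, v} \<in> D") (auto dest: card_Suc_Diff1)
  then show ?thesis by (simp only: del D_def)
qed

lemma laplacian_matching_poly_eq:
  assumes "simple_graph G"
  shows "laplacian_matching_poly G =
    matching_sum (edges G) (\<lambda>v. [:- real (edge_degree (edges G) v), 1:]) (verts G)"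
proof -
  have "edges G \<inter> Pow (verts G) = edges G" using assms by (auto simp: simple_graph_def)
  then show ?thesis
    by (simp add: laplacian_matching_poly_def matching_sum_def matchings_within_def matching_def
        vertex_degree_def)
qed

text \<open>In the expansion at a vertex, only \<open>[:- w v, 1:]\<close> times the sum over
  \<open>T - {v}\<close> reaches degree \<open>card T\<close>.\<close>

lemma matching_sum_monic:
  fixes w :: "'a \<Rightarrow> 'b::idom"
  assumes "finite T" "\<forall>e\<in>E. card e = 2"
  shows "degree (matching_sum E (\<lambda>v. [:- w v, 1:]) T) = card T"
    and "lead_coeff (matching_sum E (\<lambda>v. [:- w v, 1:]) T) = 1"
proof -
  let ?f = "matching_sum E (\<lambda>v. [:- w v, 1:])"
  have "degree (?f T) \<le> card T \<and> coeff (?f T) (card T) = 1"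
    using assms(1)
  proof (induction "card T" arbitrary: T rule: less_induct)
    case less
    show ?case
    proof (cases "T = {}")
      case True
      then show ?thesis by (simp add: matching_sum_empty[OF assms(2)])
    next
      case False
      then obtain v where v: "v \<in> T" by blast
      define k where "k = card (T - {v})"
      have k: "card T = Suc k" unfolding k_def using card_Suc_Diff1[OF less.prems v] by simp
      let ?s = "\<Sum>u | u \<in> T \<and> {u, v} \<in> E. ?f (T - {u, v})"
      have IH: "degree (?f (T - {v})) \<le> k" "coeff (?f (T - {v})) k = 1"
        using less.hyps[of "T - {v}"] less.prems k by (simp_all add: k_def)
      have "degree (?f (T - {u, v})) \<le> k" if "u \<in> T" for u
      proof -
        have "card (T - {u, v}) \<le> k"
          unfolding k_def using less.prems by (intro card_mono) auto
        then show ?thesis using less.hyps[of "T - {u, v}"] less.prems k by fastforce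
      qed
      then have s: "degree ?s \<le> k" by (intro degree_sum_le) (use less.prems in auto)
      have f: "?f T = [:- w v, 1:] * ?f (T - {v}) - ?s"
        by (rule matching_sum_expand[OF less.prems v assms(2)])
      have "degree ([:- w v, 1:] * ?f (T - {v})) \<le> Suc k"
        using degree_mult_le[of "[:- w v, 1:]" "?f (T - {v})"] IH(1) by simp
      then have "degree (?f T) \<le> Suc k" unfolding f using s by (intro degree_diff_le) auto
      moreover have "coeff (?f T) (Suc k) = 1"
        unfolding f using IH s by (simp add: coeff_eq_0)
      ultimately show ?thesis by (simp add: k)
    qed
  qed
  then show "degree (?f T) = card T" "lead_coeff (?f T) = 1"
    by (metis le_antisym le_degree zero_neq_one)+
qed

section \<open>Ratios of matching sums in the upper half plane\<close>

lemma Im_inverse_neg: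
  assumes "Im z > 0"
  shows "Im (inverse z) < 0"
proof -
  have "(Re z)\<^sup>2 + (Im z)\<^sup>2 > 0" using assms by (simp add: add_nonneg_pos)
  then show ?thesis using assms by (simp add: divide_neg_pos)
qed

text \<open>By the expansion at \<open>v\<close>, the ratio of the sums over \<open>T\<close> and \<open>T - {v}\<close> is \<open>a v\<close> minus
  reciprocals of ratios of the same kind, and reciprocals reverse the sign of the imaginary part.\<close>

lemma matching_sum_upper_half_plane:
  fixes a :: "'a \<Rightarrow> complex"
  assumes "finite T" "\<forall>e\<in>E. card e = 2" "\<And>v. Im (a v) > 0"
  shows "matching_sum E a T \<noteq> 0"
    and "v \<in> T \<Longrightarrow> Im (matching_sum E a T / matching_sum E a (T - {v})) > 0"
proof -
  let ?f = "matching_sum E a"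
  have "?f T \<noteq> 0 \<and> (\<forall>v\<in>T. Im (?f T / ?f (T - {v})) > 0)"
    using assms(1)
  proof (induction "card T" arbitrary: T rule: less_induct)
    case less
    have ratio: "Im (?f T / ?f (T - {v})) > 0" if v: "v \<in> T" for v
    proof -
      let ?N = "{u. u \<in> T \<and> {u, v} \<in> E}"
      have c: "card (T - {v}) < card T" using v less.prems by (rule card_Diff1_less[rotated])
      then have nz: "?f (T - {v}) \<noteq> 0" using less.hyps less.prems by blast
      have neg: "Im (?f (T - {u, v}) / ?f (T - {v})) < 0" if u: "u \<in> ?N" for u
      proof -
        have "u \<noteq> v" using u assms(2) by force
        then have "u \<in> T - {v}" using u by blast
        then have "Im (?f (T - {v}) / ?f (T - {v} - {u})) > 0"
          using less.hyps[OF c] less.prems by blast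
        then have "Im (inverse (?f (T - {v}) / ?f (T - {v} - {u}))) < 0" by (rule Im_inverse_neg)
        moreover have "T - {v} - {u} = T - {u, v}" by auto
        ultimately show ?thesis by simp
      qed
      have "?f T / ?f (T - {v}) = a v - (\<Sum>u\<in>?N. ?f (T - {u, v}) / ?f (T - {v}))"
        unfolding matching_sum_expand[OF less.prems v assms(2)] using nz
        by (simp add: diff_divide_distrib sum_divide_distrib)
      moreover have "(\<Sum>u\<in>?N. Im (?f (T - {u, v}) / ?f (T - {v}))) \<le> 0"
        using neg by (intro sum_nonpos) (simp add: less_imp_le)
      ultimately show ?thesis using assms(3)[of v] by simp
    qed
    moreover have "?f T \<noteq> 0"
    proof (cases "T = {}")
      case True
      then show ?thesis by (simp add: matching_sum_empty[OF assms(2)])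
    next
      case False
      then show ?thesis using ratio by fastforce
    qed
    ultimately show ?case by blast
  qed
  then show "?f T \<noteq> 0" "v \<in> T \<Longrightarrow> Im (?f T / ?f (T - {v})) > 0" by auto
qed

section \<open>Real-rooted polynomials and their lists of zeros\<close>

abbreviation cpoly :: "real poly \<Rightarrow> complex \<Rightarrow> complex" where
  "cpoly p z \<equiv> poly (map_poly complex_of_real p) z"

lemma cpoly_simps:
  "cpoly 0 z = 0" "cpoly 1 z = 1" "cpoly (pCons a p) z = of_real a + z * cpoly p z"
  "cpoly (p + q) z = cpoly p z + cpoly q z" "cpoly (smult c p) z = of_real c * cpoly p z"
proof -
  show pc: "cpoly (pCons a p) z = of_real a + z * cpoly p z" for a p
    by (cases "a = 0 \<and> p = 0") (auto simp: map_poly_pCons)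
  show "cpoly 0 z = 0" "cpoly 1 z = 1" by simp_all
  show add: "cpoly (p + q) z = cpoly p z + cpoly q z" for p q
  proof (induction p arbitrary: q)
    case (pCons a p)
    obtain b q' where "q = pCons b q'" by (cases q)
    then show ?case using pCons.IH[of q'] by (simp add: pc distrib_left[symmetric])
  qed simp
  show "cpoly (smult c p) z = of_real c * cpoly p z"
    by (induction p) (simp_all add: pc algebra_simps)
qed

lemma cpoly_mult: "cpoly (p * q) z = cpoly p z * cpoly q z"
  by (induction p) (simp_all add: cpoly_simps algebra_simps)

lemma cpoly_power: "cpoly (p ^ n) z = cpoly p z ^ n"
  by (induction n) (simp_all add: cpoly_mult)

lemma cpoly_of_real: "cpoly p (of_real x) = of_real (poly p x)"
  by (induction p) (simp_all add: cpoly_simps)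

lemma cpoly_cnj: "cpoly p (cnj z) = cnj (cpoly p z)"
  by (induction p) (simp_all add: cpoly_simps)

text \<open>Non-real zeros come in conjugate pairs, so the hypothesis says that all zeros are real.\<close>

lemma real_rooted_factorization:
  assumes "f \<noteq> 0" "\<And>z. Im z > 0 \<Longrightarrow> cpoly f z \<noteq> 0"
  shows "\<exists>xs. f = smult (lead_coeff f) (\<Prod>x\<leftarrow>xs. [:-x, 1:])"
  using assms
proof (induction "degree f" arbitrary: f)
  case 0
  from 0(1)[symmetric] obtain c where "f = [:c:]" by (rule degree_eq_zeroE)
  then show ?case by (intro exI[of _ "[]"]) simp
next
  case (Suc n)
  have "degree (map_poly complex_of_real f) = degree f" by (rule degree_map_poly) auto
  then have "\<not> constant (poly (map_poly complex_of_real f))"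
    using Suc.hyps(2) by (simp add: constant_degree)
  then obtain z where z: "cpoly f z = 0" using fundamental_theorem_of_algebra by blast
  then have "cpoly f (cnj z) = 0" by (simp add: cpoly_cnj)
  then have "\<not> Im z > 0" "\<not> Im (cnj z) > 0" using z Suc.prems(2) by blast+
  then have "Im z = 0" by simp
  then have "z = of_real (Re z)" by (simp add: complex_eq_iff)
  then have "poly f (Re z) = 0" using z cpoly_of_real[of f "Re z"] by simp
  then have "[:- Re z, 1:] dvd f" by (simp only: poly_eq_0_iff_dvd)
  then obtain g where g: "f = [:- Re z, 1:] * g" by (rule dvdE)
  have "g \<noteq> 0" using g Suc.prems(1) by auto
  moreover have "cpoly g w \<noteq> 0" if "Im w > 0" for w
    using Suc.prems(2)[OF that] unfolding g by (simp only: cpoly_mult) auto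
  moreover have "n = degree g"
    using Suc.hyps(2) \<open>g \<noteq> 0\<close> unfolding g by (subst (asm) degree_mult_eq) auto
  ultimately obtain xs where xs: "g = smult (lead_coeff g) (\<Prod>x\<leftarrow>xs. [:-x, 1:])"
    using Suc.hyps(1) by blast
  have "lead_coeff f = lead_coeff g" unfolding g by (simp only: lead_coeff_mult) simp
  moreover have "f = [:- Re z, 1:] * smult (lead_coeff g) (\<Prod>x\<leftarrow>xs. [:-x, 1:])"
    unfolding xs[symmetric] by (fact g)
  ultimately have "f = smult (lead_coeff f) (\<Prod>x\<leftarrow>Re z # xs. [:-x, 1:])"
    by (simp only: list.map prod_list.Cons mult_smult_right)
  then show ?case by blast
qed

lemma proots_linear_factors:
  fixes xs :: "'a::idom list"
  shows "proots (\<Prod>x\<leftarrow>xs. [:-x, 1:]) = mset xs"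
proof (induction xs)
  case (Cons x xs)
  have "(\<Prod>x\<leftarrow>xs. [:-x, 1:]) \<noteq> 0" by (auto simp: prod_list_zero_iff)
  with Cons show ?case by (simp only: list.map prod_list.Cons) (subst proots_mult, auto)
qed simp

lemma sorted_zeros_list: "sorted (zeros_list p)"
  by (simp add: zeros_list_def)

lemma zeros_list_eq_sort:
  assumes "mset xs = proots p"
  shows "zeros_list p = sort xs"
  by (simp add: zeros_list_def assms[symmetric])

lemma real_rooted_zeros_list:
  assumes "f \<noteq> 0" "\<And>z. Im z > 0 \<Longrightarrow> cpoly f z \<noteq> 0"
  shows "f = smult (lead_coeff f) (\<Prod>x\<leftarrow>zeros_list f. [:-x, 1:])"
    and "length (zeros_list f) = degree f"
proof -
  obtain xs where xs: "f = smult (lead_coeff f) (\<Prod>x\<leftarrow>xs. [:-x, 1:])"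
    using real_rooted_factorization[OF assms] by blast
  have "proots f = mset xs"
    using assms(1) by (subst xs) (simp add: proots_linear_factors)
  then have "mset (zeros_list f) = mset xs" by (simp add: zeros_list_def)
  \<comment> \<open>A product of linear factors depends only on the multiset of zeros, so
    \<open>xs\<close> may be replaced by the sorted list.\<close>
  then have "prod_mset (image_mset (\<lambda>x. [:-x, 1:]) (mset (zeros_list f))) =
      prod_mset (image_mset (\<lambda>x. [:-x, 1:]) (mset xs))" by simp
  then have "(\<Prod>x\<leftarrow>zeros_list f. [:-x, 1:]) = (\<Prod>x\<leftarrow>xs. [:-x, 1:])"
    by (simp only: mset_map[symmetric] prod_mset_prod_list)
  with xs show *: "f = smult (lead_coeff f) (\<Prod>x\<leftarrow>zeros_list f. [:-x, 1:])" by simp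
  have "degree (\<Prod>x\<leftarrow>ys. [:-x, 1::real:]) = length ys" for ys
  proof (induction ys)
    case (Cons y ys)
    have "(\<Prod>x\<leftarrow>ys. [:-x, 1::real:]) \<noteq> 0" by (auto simp: prod_list_zero_iff)
    with Cons show ?case by (simp only: list.map prod_list.Cons) (subst degree_mult_eq, auto)
  qed simp
  then show "length (zeros_list f) = degree f"
    using assms(1) by (subst (2) *) simp
qed

section \<open>Interlacing lists, and interlacing from the upper half plane\<close>

lemma zeros_list_linear_mult:
  assumes "p \<noteq> 0"
  shows "zeros_list ([:-r, 1:] * p) = insort r (zeros_list p)"
proof -
  have "mset (r # zeros_list p) = proots ([:-r, 1:] * p)"
    using assms by (subst proots_mult) (auto simp: zeros_list_def)
  from zeros_list_eq_sort[OF this] show ?thesis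
    by (simp add: sorted_sort_id[OF sorted_zeros_list])
qed

text \<open>The lower list comes first. Comparing \<open>a\<close> with all of \<open>bs\<close>
  rather than with its head also covers an empty tail; for sorted \<open>bs\<close> it amounts to
  the index form.\<close>

fun interlaced :: "real list \<Rightarrow> real list \<Rightarrow> bool" where
  "interlaced [] [] \<longleftrightarrow> True"
| "interlaced (b # bs) (a # as) \<longleftrightarrow> b \<le> a \<and> (\<forall>x\<in>set bs. a \<le> x) \<and> interlaced bs as"
| "interlaced _ _ \<longleftrightarrow> False"

text \<open>This puts a common zero back into both lists. For \<open>b < r \<le> a\<close> they
  become \<open>b # r # bs\<close> and \<open>r # a # as\<close>, which interlace because
  \<open>a\<close> bounds \<open>bs\<close> from below; for \<open>r > a\<close> the insertion
  happens in the tails.\<close>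

lemma interlaced_insort:
  assumes "interlaced bs as" "sorted bs" "sorted as"
  shows "interlaced (insort r bs) (insort r as)"
  using assms
proof (induction bs as rule: interlaced.induct)
  case (2 b bs a as)
  show ?case
  proof (cases "r \<le> b")
    case True
    then show ?thesis using 2 by auto
  next
    case b: False
    show ?thesis
    proof (cases "r \<le> a")
      case True
      then have "insort r bs = r # bs" using 2 by (cases bs) auto
      then show ?thesis using b True 2 by auto
    next
      case False
      then show ?thesis using b 2 by (auto simp: set_insort_key)
    qed
  qed
qed auto

lemma interlaced_iff_nth:
  assumes "sorted bs"
  shows "interlaced bs as \<longleftrightarrow> length bs = length as \<and> (\<forall>i<length as. bs ! i \<le> as ! i) \<and>
      (\<forall>i. i + 1 < length as \<longrightarrow> as ! i \<le> bs ! (i + 1))"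
  using assms
proof (induction bs as rule: interlaced.induct)
  case (2 b bs a as)
  have "(\<forall>x\<in>set bs. a \<le> x) \<longleftrightarrow> (bs \<noteq> [] \<longrightarrow> a \<le> bs ! 0)"
    using 2(2) by (cases bs) auto
  moreover have "(\<forall>i<length (a # as). (b # bs) ! i \<le> (a # as) ! i) \<longleftrightarrow>
      b \<le> a \<and> (\<forall>i<length as. bs ! i \<le> as ! i)"
    by (simp add: All_less_Suc2)
  moreover have "(\<forall>i. i + 1 < length (a # as) \<longrightarrow> (a # as) ! i \<le> (b # bs) ! (i + 1)) \<longleftrightarrow>
      (as \<noteq> [] \<longrightarrow> a \<le> bs ! 0) \<and> (\<forall>i. i + 1 < length as \<longrightarrow> as ! i \<le> bs ! (i + 1))"
    using All_less_Suc2[of "length as - 1" "\<lambda>i. (a # as) ! i \<le> bs ! i"]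
    by (cases as) (auto simp: less_Suc_eq_0_disj)
  ultimately show ?case using 2 by auto
qed auto

text \<open>Approach \<open>r\<close> along the rays at the angles \<open>\<theta>\<close> with \<open>m \<theta> = \<pi> / 2\<close> and, if \<open>m \<ge> 2\<close>, \<open>m \<theta> = 3 \<pi> / 2\<close>.\<close>

lemma residue_sign:
  fixes f1 h :: "real poly"
  assumes Im: "\<And>z. Im z > 0 \<Longrightarrow> Im (cpoly h z / cpoly ([:-r, 1:] ^ m * f1) z) \<ge> 0"
    and nz: "poly f1 r \<noteq> 0" "poly h r \<noteq> 0" and m: "m > 0"
  shows "m = 1" "poly h r * poly f1 r < 0"
proof -
  define c where "c = poly h r / poly f1 r"
  have key: "c * sin (real m * \<theta>) \<le> 0" if \<theta>: "0 < \<theta>" "\<theta> < pi" for \<theta> :: real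
  proof -
    \<comment> \<open>\<open>q\<close> is the quotient of the hypothesis, taken at distance
      \<open>\<epsilon>\<close> from \<open>r\<close>, times \<open>\<epsilon> ^ m\<close>. Its
      limit has imaginary part \<open>- c * sin (real m * \<theta>)\<close>, which must be
      nonnegative.\<close>
    define q where "q \<epsilon> = cpoly h (r + of_real \<epsilon> * cis \<theta>) / cpoly f1 (r + of_real \<epsilon> * cis \<theta>) / cis (real m * \<theta>)"
      for \<epsilon> :: real
    have lim: "(q \<longlongrightarrow> of_real c / cis (real m * \<theta>)) (at_right 0)"
    proof -
      have "((\<lambda>\<epsilon>::real. r + of_real \<epsilon> * cis \<theta>) \<longlongrightarrow> of_real r + of_real 0 * cis \<theta>) (at_right 0)"
        by (intro tendsto_intros)
      then have t: "((\<lambda>\<epsilon>. cpoly p (r + of_real \<epsilon> * cis \<theta>)) \<longlongrightarrow> of_real (poly p r)) (at_right 0)" for p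
        unfolding cpoly_of_real[symmetric] by (intro tendsto_intros) simp
      show ?thesis unfolding q_def[abs_def] c_def of_real_divide
        by (intro tendsto_intros t) (use nz in auto)
    qed
    have "Im (q \<epsilon>) \<ge> 0" if \<epsilon>: "\<epsilon> > 0" for \<epsilon>
    proof -
      let ?z = "r + of_real \<epsilon> * cis \<theta>"
      have "Im ?z > 0" using \<epsilon> \<theta> by (simp add: sin_gt_zero)
      from Im[OF this] have "0 \<le> Im (cpoly h ?z / ((?z - of_real r) ^ m * cpoly f1 ?z))"
        by (simp add: cpoly_mult cpoly_power cpoly_simps)
      also have "(?z - of_real r) ^ m = of_real (\<epsilon> ^ m) * cis (real m * \<theta>)"
        by (simp add: power_mult_distrib DeMoivre)
      also have "cpoly h ?z / (of_real (\<epsilon> ^ m) * cis (real m * \<theta>) * cpoly f1 ?z) = q \<epsilon> / of_real (\<epsilon> ^ m)"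
        by (simp add: q_def)
      finally show ?thesis using zero_less_power[OF \<epsilon>, of m]
        by (simp only: Im_divide_of_real zero_le_divide_iff) linarith
    qed
    then have "eventually (\<lambda>\<epsilon>. Im (q \<epsilon>) \<ge> 0) (at_right 0)"
      by (simp add: eventually_at_right_less eventually_mono[OF eventually_at_right_less])
    then have "0 \<le> Im (of_real c / cis (real m * \<theta>))"
      by (rule tendsto_lowerbound[OF tendsto_Im[OF lim]]) simp
    then show ?thesis by (simp add: divide_inverse)
  qed
  have c0: "c \<noteq> 0" using nz by (simp add: c_def)
  have "c * sin (pi / 2) \<le> 0"
    using key[of "pi / (2 * m)"] m by (simp add: field_simps)
  then have c: "c < 0" using c0 by simp
  then show "poly h r * poly f1 r < 0" by (simp add: c_def divide_less_0_iff mult_less_0_iff)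
  show "m = 1"
  proof (rule ccontr)
    assume "m \<noteq> 1"
    \<comment> \<open>This keeps the angle \<open>3 * pi / (2 * m)\<close> below \<open>pi\<close>;
      there the sine is -1, so \<open>c\<close> could not be negative.\<close>
    then have "m \<ge> 2" using m by simp
    then have "c * sin (3 / 2 * pi) \<le> 0"
      using key[of "3 * pi / (2 * m)"] by (simp add: field_simps)
    moreover have "sin (3 / 2 * pi) = -1" using sin_3over2_pi by simp
    ultimately show False using c by simp
  qed
qed

text \<open>By \<open>residue_sign\<close> the zeros \<open>b i\<close> of \<open>f\<close> are
  simple, and at each of them \<open>h\<close> has the sign opposite to the derivative of
  \<open>f\<close>; these signs alternate. So \<open>h\<close> has a zero between consecutive
  \<open>b i\<close>, and one more beyond the last, where it is negative with positive leading
  coefficient. The degree leaves room for no others.\<close>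

lemma interlaced_no_common_zero:
  fixes f h :: "real poly"
  assumes deg: "degree f = degree h" and lc: "lead_coeff f > 0" "lead_coeff h > 0"
    and Im: "\<And>z. Im z > 0 \<Longrightarrow> Im (cpoly h z / cpoly f z) > 0"
    and common: "\<And>r. poly f r = 0 \<Longrightarrow> poly h r \<noteq> 0"
  shows "interlaced (zeros_list f) (zeros_list h)"
proof -
  define b where "b i = zeros_list f ! i" for i
  define n where "n = length (zeros_list f)"
  \<comment> \<open>\<open>P i\<close> is \<open>f\<close> without its linear factor at position
    \<open>i\<close>; at \<open>b i\<close> it takes the value of the derivative of
    \<open>f\<close>.\<close>
  define P where "P i = smult (lead_coeff f) (\<Prod>j\<in>{..<n} - {i}. [:- b j, 1:])" for i
  have f0: "f \<noteq> 0" using lc by auto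
  have fz: "cpoly f z \<noteq> 0" if "Im z > 0" for z using Im[OF that] by auto
  note fact = real_rooted_zeros_list[OF f0 fz]
  have n: "n = degree f" by (simp add: n_def fact(2))
  have "map (\<lambda>x. [:-x, 1:]) (zeros_list f) = map (\<lambda>i. [:- b i, 1:]) [0..<n]"
    by (rule nth_equalityI) (auto simp: n_def b_def)
  then have "(\<Prod>x\<leftarrow>zeros_list f. [:-x, 1:]) = (\<Prod>i<n. [:- b i, 1:])"
    using prod.distinct_set_conv_list[of "[0..<n]" "\<lambda>i. [:- b i, 1:]"]
    by (simp add: atLeast0LessThan)
  then have f: "f = smult (lead_coeff f) (\<Prod>i<n. [:- b i, 1:])" using fact(1) by simp
  have fP: "f = [:- b i, 1:] * P i" if "i < n" for i
  proof -
    have "(\<Prod>i<n. [:- b i, 1:]) = [:- b i, 1:] * (\<Prod>j\<in>{..<n} - {i}. [:- b j, 1:])"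
      using that by (intro prod.remove) auto
    then show ?thesis by (subst f) (simp only: P_def mult_smult_right)
  qed
  have root: "poly f (b i) = 0" if "i < n" for i
    unfolding fP[OF that] by simp
  \<comment> \<open>If \<open>P i\<close> vanished at \<open>b i\<close>, this would be a zero of
    \<open>f\<close> of order at least 2, whereas \<open>residue_sign\<close> with \<open>m\<close>
    the order gives 1.\<close>
  have simple: "poly (P i) (b i) \<noteq> 0" if i: "i < n" for i
  proof
    assume "poly (P i) (b i) = 0"
    then have "[:- b i, 1:] dvd P i" by (simp only: poly_eq_0_iff_dvd)
    then have "[:- b i, 1:] ^ 2 dvd f"
      by (subst fP[OF i]) (simp only: power2_eq_square mult_dvd_mono dvd_refl)
    then have "order (b i) f \<ge> 2" using f0 by (simp only: order_divides) auto
    moreover obtain f1 where f1: "f = [:- b i, 1:] ^ order (b i) f * f1" "\<not> [:- b i, 1:] dvd f1"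
      using order_decomp[OF f0] by blast
    have "poly f1 (b i) \<noteq> 0" using f1(2) by (simp only: poly_eq_0_iff_dvd) auto
    then have "order (b i) f = 1"
      using residue_sign(1)[of h "b i" "order (b i) f" f1] Im common[OF root[OF i]] \<open>order (b i) f \<ge> 2\<close>
      unfolding f1(1)[symmetric] by (simp add: less_imp_le)
    ultimately show False by simp
  qed
  have sgn: "poly h (b i) * poly (P i) (b i) < 0" if i: "i < n" for i
    using residue_sign(2)[of h "b i" 1 "P i"] Im simple[OF i] common[OF root[OF i]]
    unfolding power_one_right fP[OF i, symmetric] by (simp add: less_imp_le)
  have Pb: "poly (P i) x = lead_coeff f * (\<Prod>j\<in>{..<n} - {i}. x - b j)" for i x
    by (simp add: P_def poly_prod)
  have less: "b i < b j" if "i < j" "j < n" for i j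
  proof -
    have "b i \<le> b j" using that sorted_nth_mono[OF sorted_zeros_list] by (simp add: b_def n_def)
    moreover have "b i \<noteq> b j"
    proof
      assume "b i = b j"
      then have "poly (P i) (b i) = 0" using that unfolding Pb by (auto intro!: prod_zero)
      then show False using simple that by simp
    qed
    ultimately show ?thesis by simp
  qed
  have alt: "poly h (b i) * poly h (b (Suc i)) < 0" if i: "Suc i < n" for i
  proof -
    define R where "R = {..<n} - {i, Suc i}"
    have "{..<n} - {i} = insert (Suc i) R" "{..<n} - {Suc i} = insert i R"
      using i by (auto simp: R_def)
    moreover have "finite R" "i \<notin> R" "Suc i \<notin> R" by (auto simp: R_def)
    \<comment> \<open>With \<open>d = b i - b (Suc i)\<close>, the factors \<open>d\<close> and
      \<open>- d\<close> multiply to minus a square. At each \<open>j\<close> in \<open>R\<close>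
      the two differences have equal sign, because no \<open>b j\<close> lies between these
      neighbours.\<close>
    moreover have "L * (d * X) * (L * (- d * Y)) = - ((L * d)\<^sup>2 * (X * Y))" for L d X Y :: real
      by (simp add: power2_eq_square)
    note this[of "lead_coeff f" "b i - b (Suc i)"]
    ultimately have "poly (P i) (b i) * poly (P (Suc i)) (b (Suc i)) =
        - ((lead_coeff f * (b i - b (Suc i)))\<^sup>2 * (\<Prod>j\<in>R. (b i - b j) * (b (Suc i) - b j)))"
      unfolding Pb by (simp add: prod.distrib)
    moreover have "(\<Prod>j\<in>R. (b i - b j) * (b (Suc i) - b j)) > 0"
    proof (rule prod_pos)
      fix j assume "j \<in> R"
      then have "j < i \<or> Suc i < j" "j < n" by (auto simp: R_def)
      then show "(b i - b j) * (b (Suc i) - b j) > 0"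
        using less[of j i] less[of j "Suc i"] less[of i j] less[of "Suc i" j] i
        by (auto simp: zero_less_mult_iff)
    qed
    moreover have "lead_coeff f * (b i - b (Suc i)) \<noteq> 0" using less[of i "Suc i"] i f0 by simp
    ultimately have "poly (P i) (b i) * poly (P (Suc i)) (b (Suc i)) < 0" by simp
    moreover have "(poly h (b i) * poly (P i) (b i)) * (poly h (b (Suc i)) * poly (P (Suc i)) (b (Suc i))) > 0"
      by (intro mult_neg_neg sgn) (use i in auto)
    then have "(poly h (b i) * poly h (b (Suc i))) * (poly (P i) (b i) * poly (P (Suc i)) (b (Suc i))) > 0"
      by (simp only: ac_simps)
    ultimately show ?thesis by (meson less_imp_le linorder_not_less mult_nonneg_nonpos)
  qed
  have last: "poly h (b i) < 0" if i: "Suc i = n" for i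
  proof -
    have "poly (P i) (b i) > 0"
      unfolding Pb using lc(1) i less by (intro mult_pos_pos prod_pos) auto
    then show ?thesis using sgn[of i] i by (simp add: mult_less_0_iff)
  qed
  have "\<exists>x. b i < x \<and> (Suc i < n \<longrightarrow> x < b (Suc i)) \<and> poly h x = 0" if i: "i < n" for i
  proof (cases "Suc i < n")
    case True
    then show ?thesis using poly_IVT[OF less[of i "Suc i"] alt[of i]] by auto
  next
    case False
    \<comment> \<open>For the last zero, \<open>max N (b i + 1)\<close> is a point to the right of
      \<open>b i\<close> and far enough out for \<open>h\<close> to be positive.\<close>
    obtain N where N: "\<forall>x\<ge>N. poly h x \<ge> lead_coeff h" using poly_pinfty_gt_lc[OF lc(2)] by blast
    have "poly h (max N (b i + 1)) > 0" using N lc(2) by (meson less_le_trans max.cobounded1)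
    then have "\<exists>x>b i. x < max N (b i + 1) \<and> poly h x = 0"
      using poly_IVT_pos[of "b i" "max N (b i + 1)" h] last[of i] i False by auto
    then show ?thesis using False by auto
  qed
  then have "\<forall>i. \<exists>x. i < n \<longrightarrow> b i < x \<and> (Suc i < n \<longrightarrow> x < b (Suc i)) \<and> poly h x = 0"
    by blast
  then obtain a where "\<forall>i. i < n \<longrightarrow> b i < a i \<and> (Suc i < n \<longrightarrow> a i < b (Suc i)) \<and> poly h (a i) = 0"
    by (rule choice[THEN exE])
  then have a: "\<And>i. i < n \<Longrightarrow> b i < a i" "\<And>i. Suc i < n \<Longrightarrow> a i < b (Suc i)"
      "\<And>i. i < n \<Longrightarrow> poly h (a i) = 0" by auto
  have a_less: "a i < a j" if "i < j" "j < n" for i j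
  proof -
    have "a i < b (Suc i)" using a(2) that by simp
    also have "b (Suc i) \<le> b j" using less[of "Suc i" j] that by (cases "Suc i = j") auto
    also have "b j < a j" using a(1) that by simp
    finally show ?thesis .
  qed
  define as where "as = map a [0..<n]"
  have srt: "sorted_wrt (<) as" using a_less by (simp add: as_def sorted_wrt_iff_nth_less)
  then have dist: "distinct as" "sorted as" by (simp_all add: strict_sorted_iff)
  have h0: "h \<noteq> 0" using lc by auto
  \<comment> \<open>The \<open>a i\<close> are \<open>n\<close> distinct zeros and \<open>h\<close>
    has degree \<open>n\<close>, so they exhaust its zeros, multiplicities included.\<close>
  have "mset as \<subseteq># proots h"
  proof (rule mset_subset_eqI)
    fix x
    have "count (mset as) x = (if x \<in> set as then 1 else 0)"
      using dist(1) by (simp add: distinct_count_atmost_1)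
    moreover have "order x h \<ge> 1" if "x \<in> set as"
    proof -
      have "poly h x = 0" using that a(3) by (auto simp: as_def)
      then show ?thesis using h0 by (simp add: order_root Suc_le_eq)
    qed
    ultimately show "count (mset as) x \<le> count (proots h) x" using h0 by simp
  qed
  moreover have "size (proots h) \<le> size (mset as)"
    using size_proots_le[of h] by (simp add: as_def n deg)
  ultimately have "mset as = proots h"
    using mset_subset_size[of "mset as" "proots h"] by (auto simp: subset_mset.le_less)
  then have "zeros_list h = as"
    using zeros_list_eq_sort dist(2) by (metis sorted_sort_id)
  moreover have "length as = n" by (simp add: as_def)
  ultimately show ?thesis
    using a unfolding interlaced_iff_nth[OF sorted_zeros_list]
    by (auto simp: as_def n_def b_def less_imp_le)
qed

text \<open>A common factor \<open>x - r\<close> cancels in \<open>h / f\<close>, so the hypothesis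
  passes to the cofactors, and restoring the factor inserts \<open>r\<close> into both lists.
  Induction on the degree reduces to the case without common zeros.\<close>

theorem interlaced_of_upper_half_plane:
  fixes f h :: "real poly"
  assumes "degree f = degree h" "lead_coeff f > 0" "lead_coeff h > 0"
    and "\<And>z. Im z > 0 \<Longrightarrow> Im (cpoly h z / cpoly f z) > 0"
  shows "interlaced (zeros_list f) (zeros_list h)"
  using assms
proof (induction "degree f" arbitrary: f h rule: less_induct)
  case less
  show ?case
  proof (cases "\<exists>r. poly f r = 0 \<and> poly h r = 0")
    case False
    then show ?thesis using interlaced_no_common_zero less.prems by blast
  next
    case True
    then obtain r where "[:-r, 1:] dvd f" "[:-r, 1:] dvd h" by (auto simp only: poly_eq_0_iff_dvd)
    then obtain f1 h1 where fh: "f = [:-r, 1:] * f1" "h = [:-r, 1:] * h1" by (auto elim!: dvdE)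
    have nz: "f1 \<noteq> 0" "h1 \<noteq> 0" using less.prems(2,3) fh by auto
    have deg: "degree f = Suc (degree f1)" "degree h = Suc (degree h1)"
      unfolding fh using nz by (subst degree_mult_eq; simp)+
    have "lead_coeff f = lead_coeff f1" "lead_coeff h = lead_coeff h1"
      unfolding fh by (simp_all only: lead_coeff_mult) simp_all
    moreover have "Im (cpoly h1 z / cpoly f1 z) > 0" if z: "Im z > 0" for z
    proof -
      have "cpoly [:-r, 1:] z \<noteq> 0" using z by (auto simp: cpoly_simps complex_eq_iff)
      then have "cpoly h z / cpoly f z = cpoly h1 z / cpoly f1 z"
        unfolding fh cpoly_mult by simp
      then show ?thesis using less.prems(4)[OF z] by simp
    qed
    ultimately have "interlaced (zeros_list f1) (zeros_list h1)"
      using less.hyps[of f1 h1] less.prems deg by simp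
    then show ?thesis
      unfolding fh zeros_list_linear_mult[OF nz(1)] zeros_list_linear_mult[OF nz(2)]
      by (intro interlaced_insort sorted_zeros_list)
  qed
qed

section \<open>Laplacian matching polynomials under edge deletion\<close>

lemma cpoly_matching_sum:
  "cpoly (matching_sum E a T) z = matching_sum E (\<lambda>v. cpoly (a v) z) T"
proof -
  have sum: "cpoly (sum f S) z = (\<Sum>x\<in>S. cpoly (f x) z)" for f :: "'x \<Rightarrow> real poly" and S
    by (induction S rule: infinite_finite_induct) (simp_all add: cpoly_simps)
  have prod: "cpoly (prod f S) z = (\<Prod>x\<in>S. cpoly (f x) z)" for f :: "'x \<Rightarrow> real poly" and S
    by (induction S rule: infinite_finite_induct) (simp_all add: cpoly_mult)
  have "cpoly (-1) z = -1"
    using cpoly_simps(3)[of "-1" 0 z] by (simp add: one_pCons)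
  then show ?thesis
    by (simp add: matching_sum_def sum prod cpoly_mult cpoly_power)
qed

lemma cpoly_linear: "cpoly [:- c, 1:] z = z - of_real c"
  by (simp add: cpoly_simps)

lemma simple_graph_delete_edge: "simple_graph G \<Longrightarrow> simple_graph (delete_edge G e)"
  by (auto simp: simple_graph_def delete_edge_def)

lemma simple_graph_finite_edges: "simple_graph G \<Longrightarrow> finite (edges G)"
  by (rule finite_subset[of _ "Pow (verts G)"]) (auto simp: simple_graph_def)

lemma laplacian_matching_poly_monic:
  assumes "simple_graph G"
  shows "degree (laplacian_matching_poly G) = card (verts G)"
    and "lead_coeff (laplacian_matching_poly G) = 1"
  using matching_sum_monic[of "verts G" "edges G"] assms
  unfolding laplacian_matching_poly_eq[OF assms] by (simp_all add: simple_graph_def)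

text \<open>For \<open>z\<close> in the upper half plane all weights lie there too, so the
  polynomial does not vanish at \<open>z\<close>; hence all its zeros are real.\<close>

lemma laplacian_matching_poly_real_rooted:
  assumes "simple_graph G"
  shows "length (zeros_list (laplacian_matching_poly G)) = card (verts G)"
proof -
  have "cpoly (laplacian_matching_poly G) z \<noteq> 0" if "Im z > 0" for z
    unfolding laplacian_matching_poly_eq[OF assms] cpoly_matching_sum cpoly_linear
    using assms that by (intro matching_sum_upper_half_plane) (auto simp: simple_graph_def)
  moreover have "laplacian_matching_poly G \<noteq> 0"
    using laplacian_matching_poly_monic(2)[OF assms] by auto
  ultimately show ?thesis
    by (simp add: real_rooted_zeros_list(2) laplacian_matching_poly_monic(1)[OF assms])
qed

theorem laplacian_matching_poly_interlaced:
  assumes G: "simple_graph G" and e: "e \<in> edges G"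
  shows "interlaced (zeros_list (laplacian_matching_poly (delete_edge G e)))
    (zeros_list (laplacian_matching_poly G))"
proof (rule interlaced_of_upper_half_plane)
  let ?f = "laplacian_matching_poly (delete_edge G e)" and ?h = "laplacian_matching_poly G"
  let ?V = "verts G" and ?E = "edges G - {e}"
  note G' = simple_graph_delete_edge[OF G, of e]
  have ev: "edges (delete_edge G e) = ?E" "verts (delete_edge G e) = ?V"
    by (simp_all add: delete_edge_def)
  show "degree ?f = degree ?h"
    by (simp only: laplacian_matching_poly_monic(1)[OF G] laplacian_matching_poly_monic(1)[OF G'] ev)
  show "lead_coeff ?f > 0" "lead_coeff ?h > 0"
    unfolding laplacian_matching_poly_monic(2)[OF G] laplacian_matching_poly_monic(2)[OF G'] by simp_all
  fix z assume z: "Im z > 0"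
  have card2: "\<forall>e\<in>edges G. card e = 2" and fin: "finite ?V" and "e \<subseteq> ?V" "card e = 2"
    using G e by (auto simp: simple_graph_def)
  then obtain u v where uv: "e = {u, v}" "u \<in> ?V" "v \<in> ?V" by (auto simp: card_2_iff)
  \<comment> \<open>These are the weights of the graph without \<open>e\<close>; those of
    \<open>G\<close> are smaller by 1 at the two endpoints.\<close>
  define a where "a w = z - of_real (edge_degree ?E w)" for w
  have b: "(\<lambda>w. z - of_real (edge_degree (edges G) w)) =
      (\<lambda>w. if w = u \<or> w = v then a w - 1 else a w)"
    using edge_degree_delete_edge[OF simple_graph_finite_edges[OF G], of u v] e uv(1)
    by (auto simp: a_def fun_eq_iff)
  have f: "cpoly ?f z = matching_sum ?E a ?V"
    unfolding laplacian_matching_poly_eq[OF G'] cpoly_matching_sum cpoly_linear ev a_def by simp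
  have h: "cpoly ?h z = matching_sum ?E a ?V - matching_sum ?E a (?V - {u}) - matching_sum ?E a (?V - {v})"
    unfolding laplacian_matching_poly_eq[OF G] cpoly_matching_sum cpoly_linear
    using matching_sum_laplacian_edge[OF fin card2 _ uv(2,3) b] e uv(1) by simp
  have a: "Im (a w) > 0" for w using z by (simp add: a_def)
  have E: "\<forall>e\<in>?E. card e = 2" using card2 by auto
  note uhp = matching_sum_upper_half_plane[OF fin E a]
  have neg: "Im (matching_sum ?E a (?V - {w}) / matching_sum ?E a ?V) < 0" if "w \<in> ?V" for w
    using Im_inverse_neg[OF uhp(2)[OF that]] by simp
  \<comment> \<open>Each subtracted quotient is the reciprocal of a ratio in the upper half plane,
    so its imaginary part is negative.\<close>
  have "cpoly ?h z / cpoly ?f z = 1 - matching_sum ?E a (?V - {u}) / matching_sum ?E a ?V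
      - matching_sum ?E a (?V - {v}) / matching_sum ?E a ?V"
    unfolding f h using uhp(1) by (simp add: diff_divide_distrib)
  then show "Im (cpoly ?h z / cpoly ?f z) > 0" using neg[OF uv(2)] neg[OF uv(3)] by simp
qed

section \<open>Largest zeros of proper subgraphs of a connected graph\<close>

lemma connected_graph_crossing_edge:
  assumes G: "simple_graph G" "connected_graph G" and T: "T \<subset> verts G" "T \<noteq> {}"
  obtains u v where "{u, v} \<in> edges G" "u \<in> T" "v \<in> verts G - T"
proof -
  obtain x y where xy: "x \<in> T" "y \<in> verts G - T" using T by blast
  then have "(x, y) \<in> {(x, y). {x, y} \<in> edges G}\<^sup>*"
    using G(2) T(1) by (auto simp: connected_graph_def)
  \<comment> \<open>A path that starts in \<open>T\<close> either ends in \<open>T\<close> or has a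
    step that leaves it.\<close>
  then have "y \<in> T \<or> (\<exists>u v. {u, v} \<in> edges G \<and> u \<in> T \<and> v \<notin> T)"
    by (induction rule: rtrancl_induct) (use xy(1) in auto)
  then obtain u v where "{u, v} \<in> edges G" "u \<in> T" "v \<notin> T" using xy(2) by blast
  moreover from this have "v \<in> verts G" using G(1) by (auto simp: simple_graph_def)
  ultimately show thesis using that by blast
qed

text \<open>Induction on the size of \<open>T\<close>. Were the sum over \<open>T\<close> zero,
  expanding the sum over \<open>insert v T\<close> at an outside vertex \<open>v\<close> adjacent to
  \<open>T\<close> would leave minus a nonempty sum of terms for sets \<open>T - {w}\<close>,
  positive by induction, against nonnegativity.\<close>

lemma connected_matching_sum_pos:
  fixes a :: "'a \<Rightarrow> real"
  assumes G: "simple_graph G" "connected_graph G"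
    and nonneg: "\<And>T. T \<subseteq> verts G \<Longrightarrow> matching_sum (edges G) a T \<ge> 0"
    and T: "T \<subset> verts G"
  shows "matching_sum (edges G) a T > 0"
  using T
proof (induction "card T" arbitrary: T rule: less_induct)
  case less
  let ?f = "matching_sum (edges G) a"
  have E: "\<forall>e\<in>edges G. card e = 2" and fin: "finite (verts G)" using G(1) by (auto simp: simple_graph_def)
  then have finT: "finite T" using less.prems finite_subset by blast
  show ?case
  proof (cases "T = {}")
    case True
    then show ?thesis by (simp add: matching_sum_empty[OF E])
  next
    case False
    obtain u v where uv: "{u, v} \<in> edges G" "u \<in> T" "v \<in> verts G - T"
      using connected_graph_crossing_edge[OF G less.prems False] .
    let ?N = "{w. w \<in> insert v T \<and> {w, v} \<in> edges G}"
    have pos: "?f (insert v T - {w, v}) > 0" if "w \<in> ?N" for w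
    proof -
      have "w \<noteq> v" using that E by force
      then have "insert v T - {w, v} = T - {w}" "w \<in> T" using uv that by auto
      then show ?thesis
        using less.hyps[of "T - {w}"] less.prems finT by (metis card_Diff1_less Diff_subset subset_psubset_trans)
    qed
    have "(\<Sum>w\<in>?N. ?f (insert v T - {w, v})) > 0"
      using pos uv finT by (intro sum_pos) auto
    moreover have "?f (insert v T) = a v * ?f T - (\<Sum>w\<in>?N. ?f (insert v T - {w, v}))"
      using matching_sum_expand[of "insert v T" v "edges G" a] finT uv E by simp
    moreover have "?f (insert v T) \<ge> 0" "?f T \<ge> 0" using nonneg uv less.prems by auto
    ultimately show ?thesis by (cases "?f T = 0") auto
  qed
qed

text \<open>The weights are \<open>b\<close> before the deletion and \<open>a\<close> after it. With
  one endpoint \<open>y\<close> in \<open>T\<close>, the weight of \<open>y\<close> rises by 1,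
  which adds a nonnegative term to a positive sum, as \<open>T\<close> is proper. With both, the
  edge identity gives the old sum plus two sums of the one-endpoint kind. With none,
  \<open>T\<close> is proper and its sum is unchanged.\<close>

lemma matching_sum_pos_delete_edge:
  fixes a b :: "'a \<Rightarrow> real"
  assumes fin: "finite V" and E: "\<forall>e\<in>E. card e = 2" and e: "{u, v} \<in> E" "u \<in> V" "v \<in> V"
    and b: "b = (\<lambda>w. if w = u \<or> w = v then a w - 1 else a w)"
    and nonneg: "\<And>T. T \<subseteq> V \<Longrightarrow> matching_sum E b T \<ge> 0"
    and pos: "\<And>T. T \<subset> V \<Longrightarrow> matching_sum E b T > 0"
    and T: "T \<subseteq> V"
  shows "matching_sum (E - {{u, v}}) a T > 0"
proof -
  let ?E = "E - {{u, v}}"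
  have uv: "u \<noteq> v" using E e(1) by force
  have cE: "matching_sum ?E a S = matching_sum E a S" if "\<not> {u, v} \<subseteq> S" for S
    using that by (intro matching_sum_cong) auto
  have one: "matching_sum ?E a S > 0" if S: "S \<subseteq> V" "x \<notin> S" "y \<in> S" and xy: "{x, y} = {u, v}" for S x y
  proof -
    have finS: "finite S" using S(1) fin finite_subset by blast
    have "matching_sum ?E a S = matching_sum E a S"
      using S xy by (intro cE) auto
    also have "\<dots> = matching_sum E (b(y := b y + 1)) S"
      using S(2) xy by (intro matching_sum_cong) (auto simp: b doubleton_eq_iff)
    also have "\<dots> = matching_sum E b S + matching_sum E b (S - {y})"
      using matching_sum_add_weight[OF finS S(3) E, of b 1] by simp
    also have "\<dots> > 0" using S xy e by (intro add_pos_nonneg pos nonneg) (auto simp: doubleton_eq_iff)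
    finally show ?thesis .
  qed
  consider "u \<in> T" "v \<in> T" | "u \<notin> T" "v \<in> T" | "u \<in> T" "v \<notin> T" | "u \<notin> T" "v \<notin> T" by blast
  then show ?thesis
  proof cases
    case 1
    have "matching_sum ?E a T = matching_sum E b T + matching_sum ?E a (T - {u}) + matching_sum ?E a (T - {v})"
      using matching_sum_laplacian_edge[OF finite_subset[OF T fin] E e(1) 1 b] by simp
    also have "\<dots> > 0"
      using one[of "T - {u}" u v] one[of "T - {v}" v u] nonneg[OF T] T 1 uv
      by (simp add: insert_commute subset_iff)
    finally show ?thesis .
  next
    case 2
    then show ?thesis using one[of T u v] T by simp
  next
    case 3
    then show ?thesis using one[of T v u] T by (simp add: insert_commute)
  next
    case 4
    have "matching_sum ?E a T = matching_sum E a T" by (rule cE) (use 4 in auto)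
    also have "\<dots> = matching_sum E b T" using 4 by (intro matching_sum_cong) (auto simp: b)
    also have "\<dots> > 0" using 4 T e by (intro pos) auto
    finally show ?thesis .
  qed
qed

text \<open>The edges missing from \<open>F\<close> are deleted one at a time; vertices lost by a
  subgraph are accounted for by the choice of \<open>T\<close>.\<close>

lemma connected_laplacian_pos:
  fixes y :: real
  defines "s \<equiv> (\<lambda>F. matching_sum F (\<lambda>v. y - real (edge_degree F v)))"
  assumes G: "simple_graph G" "connected_graph G"
    and nonneg: "\<And>T. T \<subseteq> verts G \<Longrightarrow> s (edges G) T \<ge> 0"
    and F: "F \<subset> edges G" and T: "T \<subseteq> verts G"
  shows "s F T > 0"
proof -
  have V: "finite (verts G)" and E: "\<forall>e\<in>edges G. card e = 2 \<and> e \<subseteq> verts G"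
    using G(1) by (auto simp: simple_graph_def)
  have finE: "finite (edges G)" using simple_graph_finite_edges[OF G(1)] .
  \<comment> \<open>Strictness on proper subsets starts from connectedness at \<open>D = {}\<close>.
    The first deletion extends it to all subsets, and each later one reproduces the three
    claims.\<close>
  have "(\<forall>T. T \<subseteq> verts G \<longrightarrow> s (edges G - D) T \<ge> 0) \<and> (\<forall>T. T \<subset> verts G \<longrightarrow> s (edges G - D) T > 0) \<and>
      (D \<noteq> {} \<longrightarrow> (\<forall>T. T \<subseteq> verts G \<longrightarrow> s (edges G - D) T > 0))"
    if "finite D" "D \<subseteq> edges G" for D
    using that
  proof (induction D)
    case empty
    then show ?case
      using nonneg connected_matching_sum_pos[OF G nonneg[unfolded s_def]] by (simp add: s_def)
  next
    case (insert e D)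
    let ?E = "edges G - D"
    have e: "e \<in> ?E" using insert by auto
    then have "card e = 2" "e \<subseteq> verts G" using E by auto
    then obtain u v where uv: "e = {u, v}" "u \<in> verts G" "v \<in> verts G" by (auto simp: card_2_iff)
    have b: "(\<lambda>w. y - real (edge_degree ?E w)) = (\<lambda>w. if w = u \<or> w = v
        then y - real (edge_degree (?E - {{u, v}}) w) - 1 else y - real (edge_degree (?E - {{u, v}}) w))"
      using edge_degree_delete_edge[of ?E u v] finE e uv(1) by (auto simp: fun_eq_iff)
    have card2: "\<forall>e\<in>?E. card e = 2" using E by auto
    have "s (?E - {{u, v}}) T > 0" if "T \<subseteq> verts G" for T
      unfolding s_def
      by (rule matching_sum_pos_delete_edge[OF V card2 _ uv(2,3) b])
        (use insert e uv(1) that in \<open>auto simp: s_def\<close>)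
    moreover have "edges G - insert e D = ?E - {{u, v}}" using uv(1) by auto
    ultimately show ?case by (auto simp: less_imp_le)
  qed
  from this[of "edges G - F"] show ?thesis
    using finE F T by (auto simp: double_diff)
qed

text \<open>Ensures that the \<open>Max\<close> in \<open>largest_zero\<close> is attained.\<close>

lemma finite_nonempty_zeros:
  assumes "simple_graph G"
  shows "finite {x. poly (laplacian_matching_poly G) x = 0}"
    and "{x. poly (laplacian_matching_poly G) x = 0} \<noteq> {}"
proof -
  let ?p = "laplacian_matching_poly G"
  have p: "?p \<noteq> 0" using laplacian_matching_poly_monic(2)[OF assms] by auto
  then show "finite {x. poly ?p x = 0}" by (rule poly_roots_finite)
  have "length (zeros_list ?p) > 0"
    using assms laplacian_matching_poly_real_rooted[OF assms] by (simp add: simple_graph_def card_gt_0_iff)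
  then have "proots ?p \<noteq> {#}" by (auto simp: zeros_list_def)
  then obtain x where "x \<in># proots ?p" by (auto simp: multiset_nonemptyE)
  then show "{x. poly ?p x = 0} \<noteq> {}" using set_count_proots[OF p] by auto
qed

text \<open>If all edges were kept, some vertex would be missing; connectedness gives an edge from a
  kept vertex to a missing one, which cannot belong to \<open>H\<close>.\<close>

lemma proper_subgraph_edges:
  assumes G: "simple_graph G" "connected_graph G" and H: "proper_subgraph H G"
  shows "edges H \<subset> edges G"
proof -
  have sub: "simple_graph H" "verts H \<subseteq> verts G" "edges H \<subseteq> edges G" "H \<noteq> G"
    using H by (auto simp: proper_subgraph_def subgraph_def)
  have "edges H \<noteq> edges G"
  proof
    assume eq: "edges H = edges G"
    then have "verts H \<noteq> verts G" using sub(4) by (metis (full_types) graph.equality old.unit.exhaust)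
    then have "verts H \<subset> verts G" "verts H \<noteq> {}" using sub by (auto simp: simple_graph_def)
    then obtain u v where "{u, v} \<in> edges G" "v \<in> verts G - verts H"
      using connected_graph_crossing_edge[OF G] by metis
    then show False using sub(1) eq by (auto simp: simple_graph_def)
  qed
  then show ?thesis using sub by blast
qed

theorem largest_zero_proper_subgraph:
  assumes G: "simple_graph G" "connected_graph G" and H: "proper_subgraph H G"
  shows "largest_zero (laplacian_matching_poly H) < largest_zero (laplacian_matching_poly G)"
proof -
  let ?V = "verts G" and ?E = "edges G"
  define f where "f T = matching_sum ?E (\<lambda>v. [:- real (edge_degree ?E v), 1:]) T" for T
  have V: "finite ?V" and E: "\<forall>e\<in>?E. card e = 2" using G(1) by (auto simp: simple_graph_def)
  have pf: "poly (f T) y = matching_sum ?E (\<lambda>v. y - real (edge_degree ?E v)) T" for T y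
    by (simp add: f_def poly_matching_sum)
  have fV: "f ?V = laplacian_matching_poly G" by (simp add: f_def laplacian_matching_poly_eq[OF G(1)])
  have lc: "lead_coeff (f T) > 0" if "T \<subseteq> ?V" for T
    unfolding f_def matching_sum_monic(2)[OF finite_subset[OF that V] E] by simp
  define Z where "Z = (\<Union>T\<in>Pow ?V. {y. poly (f T) y = 0})"
  have "f T \<noteq> 0" if "T \<subseteq> ?V" for T using lc[OF that] by auto
  then have Z: "finite Z" unfolding Z_def
    using V by (intro finite_UN_I poly_roots_finite) auto
  have "Z \<noteq> {}" using finite_nonempty_zeros(2)[OF G(1)] unfolding Z_def fV[symmetric] by blast
  define m where "m = Max Z"
  have mZ: "m \<in> Z" and Zm: "\<And>y. y \<in> Z \<Longrightarrow> y \<le> m"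
    using Z \<open>Z \<noteq> {}\<close> by (simp_all add: m_def)
  \<comment> \<open>A negative value at \<open>y\<close> would force a zero beyond \<open>y\<close>,
    hence beyond \<open>m\<close>, because the leading coefficient is positive; \<open>Z\<close>
    contains the zeros for every subset.\<close>
  have nonneg: "poly (f T) y \<ge> 0" if T: "T \<subseteq> ?V" and y: "y \<ge> m" for T y
  proof (rule ccontr)
    assume neg: "\<not> poly (f T) y \<ge> 0"
    obtain N where N: "\<forall>x\<ge>N. poly (f T) x \<ge> lead_coeff (f T)"
      using poly_pinfty_gt_lc[OF lc[OF T]] by blast
    have "poly (f T) (max N (y + 1)) > 0" using N lc[OF T] by (meson less_le_trans max.cobounded1)
    moreover have "y < max N (y + 1)" by (simp add: less_max_iff_disj)
    ultimately obtain x where "x > y" "poly (f T) x = 0"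
      using poly_IVT_pos[of y "max N (y + 1)" "f T"] neg by (auto simp del: less_max_iff_disj)
    then show False using Zm[of x] T y by (auto simp: Z_def)
  qed
  have pos: "poly (f T) y > 0" if "T \<subset> ?V" "y \<ge> m" for T y
    unfolding pf by (rule connected_matching_sum_pos[OF G _ that(1)])
      (use nonneg that(2) in \<open>simp add: pf\<close>)
  obtain T where T: "T \<subseteq> ?V" "poly (f T) m = 0" using mZ by (auto simp: Z_def)
  \<comment> \<open>Sums over proper subsets are positive at \<open>m\<close>, so \<open>m\<close>
    must be a zero of the sum over \<open>?V\<close>, the polynomial of \<open>G\<close>.\<close>
  then have "\<not> T \<subset> ?V" using pos[of T m] by auto
  then have "T = ?V" using T(1) by blast
  then have "m \<le> largest_zero (laplacian_matching_poly G)"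
    unfolding largest_zero_def using T(2) fV finite_nonempty_zeros[OF G(1)] by (intro Max_ge) auto
  moreover have "largest_zero (laplacian_matching_poly H) < m"
  proof -
    have sH: "simple_graph H" and VH: "verts H \<subseteq> ?V"
      using H by (auto simp: proper_subgraph_def subgraph_def)
    \<comment> \<open>Here \<open>verts H\<close> takes the role of \<open>T\<close> and the weights
      use the degrees in \<open>H\<close>.\<close>
    have pos: "poly (laplacian_matching_poly H) y > 0" if y: "y \<ge> m" for y
      unfolding laplacian_matching_poly_eq[OF sH] poly_matching_sum
      using connected_laplacian_pos[OF G _ proper_subgraph_edges[OF G H] VH, of y] nonneg y
      by (simp add: pf)
    have "x < m" if "poly (laplacian_matching_poly H) x = 0" for x
      using that pos[of x] by (cases "x < m") auto
    then show ?thesis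
      unfolding largest_zero_def using finite_nonempty_zeros[OF sH] by (subst Max_less_iff) auto
  qed
  ultimately show ?thesis by simp
qed

theorem theorem3p10:
  fixes G :: "'a graph" and n :: nat
  assumes "simple_graph G" and "n = card (verts G)"
  shows "(\<forall>e\<in>edges G.
            let \<alpha> = zeros_list (laplacian_matching_poly G);
                \<beta> = zeros_list (laplacian_matching_poly (delete_edge G e))
            in length \<alpha> = n \<and> length \<beta> = n \<and>
               (\<forall>i<n. \<beta> ! i \<le> \<alpha> ! i) \<and>
               (\<forall>i. i + 1 < n \<longrightarrow> \<alpha> ! i \<le> \<beta> ! (i + 1)))
       \<and> (connected_graph G \<longrightarrow>
            (\<forall>H. proper_subgraph H G \<longrightarrow>
               largest_zero (laplacian_matching_poly G) > largest_zero (laplacian_matching_poly H)))"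
proof (intro conjI ballI impI allI)
  fix e assume e: "e \<in> edges G"
  show "let \<alpha> = zeros_list (laplacian_matching_poly G);
            \<beta> = zeros_list (laplacian_matching_poly (delete_edge G e))
        in length \<alpha> = n \<and> length \<beta> = n \<and> (\<forall>i<n. \<beta> ! i \<le> \<alpha> ! i) \<and>
           (\<forall>i. i + 1 < n \<longrightarrow> \<alpha> ! i \<le> \<beta> ! (i + 1))"
    \<comment> \<open>Interlacing includes equality of the two lengths, so the number of zeros for
      \<open>G\<close> fixes both.\<close>
    using laplacian_matching_poly_interlaced[OF assms(1) e] laplacian_matching_poly_real_rooted[OF assms(1)]
    unfolding interlaced_iff_nth[OF sorted_zeros_list] assms(2) by (simp add: Let_def)
qed (rule largest_zero_proper_subgraph[OF assms(1)])

end
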